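(* For every integer $k \geqslant 3$ there exist a strictly increasing sequence of natural numbers $n_1 < n_2 < \cdots$ and a function $\delta:\mathbb{N}\to\mathbb{R}$ with $\delta(n)\to 0$ as $n\to\infty$ such that for every element $n$ of the sequence $$\phi_k(n) > \left(\tfrac14 + \delta(n)\right) g_k(n).$$ Moreover, the sequence is dense in the following sense: there is a function $\eta$ with $\eta(n)\to 0$ as $n\to\infty$ such that every segment of the form $\left[n,\; n\, e^{(\ln n)^{1/2+\eta(n)}}\right]$ contains at least one element of the sequence.
   Context: An arithmetic progression is called trivial if all its elements are equal. For a set $B \subseteq \mathbb{Z}$ and an integer $k\geqslant 3$, $f_k(B)$ denotes the maximum cardinality of a subset of $B$ containing no nontrivial arithmetic progression of length $k$. Define $\phi_k(n) := \min_{B\subseteq \mathbb{Z},\,|B|=n} f_k(B)$ and $g_k(n) := f_k(\{1,2,\dots,n\})$. *)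

theory Defs
  imports Complex_Main
begin

definition arith_prog :: "int \<Rightarrow> int \<Rightarrow> nat \<Rightarrow> int set" where
  "arith_prog a d k = (\<lambda>i. a + int i * d) ` {..<k}"

definition trivial_prog :: "int set \<Rightarrow> bool" where
  "trivial_prog P \<longleftrightarrow> (\<forall>x\<in>P. \<forall>y\<in>P. x = y)"

definition ap_free :: "nat \<Rightarrow> int set \<Rightarrow> bool" where
  "ap_free k A \<longleftrightarrow> \<not> (\<exists>a d. arith_prog a d k \<subseteq> A \<and> \<not> trivial_prog (arith_prog a d k))"

text \<open>Only meaningful for finite \<open>B\<close>; it is not applied to infinite sets below.\<close>

definition f_ap :: "nat \<Rightarrow> int set \<Rightarrow> nat" where
  "f_ap k B = Max (card ` {A. A \<subseteq> B \<and> ap_free k A})"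

text \<open>There are infinitely many sets \<open>B\<close> of size \<open>n\<close>, but the set of values is finite
  (all are at most \<open>n\<close>) and nonempty, so the minimum is a genuine one. The finiteness condition
  matters for \<open>n = 0\<close>, since infinite sets have \<open>card\<close> zero.\<close>

definition phi_ap :: "nat \<Rightarrow> nat \<Rightarrow> nat" where
  "phi_ap k n = Min (f_ap k ` {B. finite B \<and> card B = n})"

definition g_ap :: "nat \<Rightarrow> nat \<Rightarrow> nat" where
  "g_ap k n = f_ap k {1..int n}"

end

theory Submission
  imports Defs "HOL-Library.FuncSet" "HOL-Library.Infinite_Set"
    "HOL-Computational_Algebra.Primes" "HOL-Real_Asymp.Real_Asymp"
begin

text \<open>A random affine map \<open>x \<mapsto> t x + s\<close> modulo a large prime sends the points of \<open>B\<close> pairwise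
  independently into \<open>4 N\<close> equal pieces of the residues. Keep the points that land in the
  alternate pieces of the first half indexed by an optimal AP-free subset of \<open>{1..N}\<close>, and delete
  one point of each pair sharing a piece. The gaps make every progression of the remaining points
  project to a progression of indices, so what is left is AP-free. With \<open>n = card B\<close> the expected
  size is at least about \<open>n * g_ap k N / (4 * N) * (1 - n / (4 * N))\<close>.

  This is \<open>(1/4 - o(1)) * g_ap k n\<close> as soon as, for some \<open>N = n * H\<close> with \<open>H\<close> large, the density
  \<open>g_ap k N / N\<close> is almost that at \<open>n\<close>. By Behrend's theorem the density is at least
  \<open>exp (- C * sqrt (ln n))\<close>, so along \<open>n, n * H, n * H\<^sup>2, \<dots>\<close> it can lose a factor \<open>1 - 1 / H\<close> only
  about \<open>H * sqrt (ln n)\<close> times in a row; \<open>H\<close> of order \<open>ln (ln n)\<close> makes the sequence as dense as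
  claimed.\<close>

section \<open>AP-free sets and the extremal functions\<close>

lemma ap_free_iff:
  assumes "k \<ge> 2"
  shows "ap_free k A \<longleftrightarrow> (\<forall>a d. (\<forall>i<k. a + int i * d \<in> A) \<longrightarrow> d = 0)"
proof -
  have "trivial_prog (arith_prog a d k) \<longleftrightarrow> d = 0" for a d
  proof
    assume t: "trivial_prog (arith_prog a d k)"
    have "a + int i * d \<in> arith_prog a d k" if "i < k" for i
      unfolding arith_prog_def using that by blast
    from this[of 0] this[of 1] have "a \<in> arith_prog a d k" "a + d \<in> arith_prog a d k" using assms by simp_all
    with t have "a = a + d" unfolding trivial_prog_def by blast
    then show "d = 0" by simp
  qed (auto simp: trivial_prog_def arith_prog_def)
  moreover have "arith_prog a d k \<subseteq> A \<longleftrightarrow> (\<forall>i<k. a + int i * d \<in> A)" for a d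
    unfolding arith_prog_def by auto
  ultimately show ?thesis unfolding ap_free_def by blast
qed

lemma ap_free_empty: "ap_free k {}"
  by (auto simp: ap_free_def arith_prog_def trivial_prog_def)

lemma finite_ap_free_subsets: "finite B \<Longrightarrow> finite {A. A \<subseteq> B \<and> ap_free k A}"
  by (rule finite_subset[of _ "Pow B"]) auto

lemma card_le_f_ap:
  assumes "finite B" "A \<subseteq> B" "ap_free k A"
  shows "card A \<le> f_ap k B"
  unfolding f_ap_def using assms finite_ap_free_subsets by (intro Max_ge) auto

lemma f_ap_attained:
  assumes "finite B"
  obtains A where "A \<subseteq> B" "ap_free k A" "card A = f_ap k B"
proof -
  have "f_ap k B \<in> card ` {A. A \<subseteq> B \<and> ap_free k A}"
    unfolding f_ap_def using finite_ap_free_subsets[OF assms] ap_free_empty by (intro Max_in) auto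
  then show thesis using that by auto
qed

lemma f_ap_le_card: "finite B \<Longrightarrow> f_ap k B \<le> card B"
  by (metis f_ap_attained card_mono)

lemma phi_ap_attained:
  obtains B where "finite B" "card B = n" "phi_ap k n = f_ap k B"
proof -
  have "f_ap k ` {B. finite B \<and> card B = n} \<subseteq> {..n}"
    using f_ap_le_card by auto
  moreover have "int ` {..<n} \<in> {B. finite B \<and> card B = n}"
    by (simp add: card_image)
  ultimately have "phi_ap k n \<in> f_ap k ` {B. finite B \<and> card B = n}"
    unfolding phi_ap_def by (intro Min_in) (auto intro: finite_subset)
  then show thesis using that by auto
qed

lemma g_ap_le: "g_ap k n \<le> n"
  unfolding g_ap_def using f_ap_le_card[of "{1..int n}" k] by simp

lemma g_ap_pos:
  assumes "k \<ge> 2" "n \<ge> 1"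
  shows "g_ap k n \<ge> 1"
proof -
  have "ap_free k {1}"
  proof (subst ap_free_iff[OF assms(1)], intro allI impI)
    fix a d assume *: "\<forall>i<k. a + int i * d \<in> {1}"
    from *[rule_format, of 0] *[rule_format, of 1] show "d = 0" using assms by auto
  qed
  then show ?thesis unfolding g_ap_def using card_le_f_ap[of "{1..int n}" "{1}" k] assms by simp
qed

subsection \<open>Random affine images\<close>

text \<open>For each fixed \<open>t\<close> the shift by \<open>s\<close> permutes the residues, so
  the image of a single point is uniformly distributed.\<close>

lemma card_affine_preimage:
  fixes p x :: int
  assumes "p > 0" "S \<subseteq> {0..<p}"
  shows "card {(t,s). t \<in> {0..<p} \<and> s \<in> {0..<p} \<and> (t * x + s) mod p \<in> S} = nat p * card S"
proof -
  let ?f = "\<lambda>(t,s). (t, (t * x + s) mod p)" and ?g = "\<lambda>(t,y). (t, (y - t * x) mod p)"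
  have "bij_betw ?f {(t,s). t \<in> {0..<p} \<and> s \<in> {0..<p} \<and> (t * x + s) mod p \<in> S} ({0..<p} \<times> S)"
    by (rule bij_betw_byWitness[where f' = ?g]) (use assms in \<open>auto simp: mod_simps subset_iff\<close>)
  from bij_betw_same_card[OF this] show ?thesis by (simp add: card_cartesian_product)
qed

text \<open>Pairwise independence: two image values determine \<open>t\<close>, because
  \<open>x - x'\<close> is invertible modulo the prime \<open>p\<close>, and then \<open>s\<close>.
  The pair of images is thus uniform on all pairs of residues.\<close>

lemma card_affine_preimage_pair:
  fixes p x x' :: int
  assumes "prime p" "\<not> p dvd x - x'" "P \<subseteq> {0..<p} \<times> {0..<p}"
  shows "card {(t,s). t \<in> {0..<p} \<and> s \<in> {0..<p} \<and> ((t * x + s) mod p, (t * x' + s) mod p) \<in> P} = card P"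
proof -
  have p0: "p > 0" using assms(1) by (simp add: prime_gt_0_int)
  let ?Z = "{0..<p} \<times> {0..<p}"
  let ?f = "\<lambda>(t,s). ((t * x + s) mod p, (t * x' + s) mod p)"
  have "inj_on ?f ?Z"
  proof (rule inj_onI, clarsimp)
    fix t s t' s'
    assume b: "0 \<le> t" "t < p" "0 \<le> s" "s < p" "0 \<le> t'" "t' < p" "0 \<le> s'" "s' < p"
      and e: "(t * x + s) mod p = (t' * x + s') mod p" "(t * x' + s) mod p = (t' * x' + s') mod p"
    from e have d: "p dvd (t * x + s) - (t' * x + s')" "p dvd (t * x' + s) - (t' * x' + s')"
      by (simp_all add: mod_eq_dvd_iff)
    from dvd_diff[OF this] have "p dvd (t - t') * (x - x')" by (simp add: algebra_simps)
    with assms have "p dvd t - t'" by (simp add: prime_dvd_mult_iff)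
    with b have t: "t = t'" by (metis mod_eq_dvd_iff mod_pos_pos_trivial)
    with d have "p dvd s - s'" by simp
    with b have "s = s'" by (metis mod_eq_dvd_iff mod_pos_pos_trivial)
    with t show "t = t' \<and> s = s'" by simp
  qed
  moreover have "?f ` ?Z \<subseteq> ?Z" using p0 by auto
  ultimately have bij: "bij_betw ?f ?Z ?Z"
    by (simp add: bij_betw_def endo_inj_surj)
  have "h ` {z \<in> Z. h z \<in> Q} = Q" if "bij_betw h Z Z" "Q \<subseteq> Z" for h :: "int \<times> int \<Rightarrow> int \<times> int" and Z Q
  proof -
    have "{z \<in> Z. h z \<in> Q} = Z \<inter> h -` Q" by auto
    then have "h ` {z \<in> Z. h z \<in> Q} = h ` Z \<inter> Q" by auto
    then show ?thesis using that unfolding bij_betw_def by auto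
  qed
  from this[OF bij assms(3)] have "?f ` {z \<in> ?Z. ?f z \<in> P} = P" .
  moreover have inj: "inj_on ?f {z \<in> ?Z. ?f z \<in> P}" using bij unfolding bij_betw_def by (auto intro: inj_on_subset)
  ultimately have "card {z \<in> ?Z. ?f z \<in> P} = card P" using card_image[OF inj] by argo
  moreover have "{z \<in> ?Z. ?f z \<in> P} = {(t,s). t \<in> {0..<p} \<and> s \<in> {0..<p} \<and> ((t * x + s) mod p, (t * x' + s) mod p) \<in> P}"
    by auto
  ultimately show ?thesis by simp
qed

lemma second_difference_zero_imp_ap:
  fixes c :: "nat \<Rightarrow> int"
  assumes "\<And>i. i + 2 < k \<Longrightarrow> c i + c (i + 2) = 2 * c (i + 1)"
  shows "i < k \<Longrightarrow> c i = c 0 + int i * (c 1 - c 0)"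
proof (induction i rule: less_induct)
  case (less i)
  consider "i = 0" | "i = 1" | j where "i = j + 2" by (metis One_nat_def add_2_eq_Suc' not0_implies_Suc)
  then show ?case
  proof cases
    case 3
    with less.IH[of j] less.IH[of "j + 1"] less.prems assms[of j] show ?thesis by (simp add: algebra_simps)
  qed auto
qed

text \<open>Every second block of length \<open>L\<close> is a cell, and the blocks between are
  gaps. Indices start at 1 to match subsets of \<open>{1..N}\<close>.\<close>

definition cell :: "int \<Rightarrow> int \<Rightarrow> int set" where
  "cell L a = {2 * L * (a - 1) ..< 2 * L * (a - 1) + L}"

lemma cell_unique:
  assumes "y \<in> cell L a" "y \<in> cell L b"
  shows "a = b"
proof -
  have "L * (2 * (a - b)) < L * 1" "L * (2 * (b - a)) < L * 1" "L > 0"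
    using assms unfolding cell_def by (auto simp: algebra_simps)
  then have "2 * (a - b) < 1" "2 * (b - a) < 1" by (simp_all only: mult_less_cancel_left_pos)
  then show ?thesis by presburger
qed

text \<open>The last cell ends at \<open>2 * L * (N - 1) + L\<close>, which is below
  \<open>p / 2\<close>. Keeping to the first half of the residues costs a factor 2 and the gaps
  another 2: this is the origin of the constant 1/4.\<close>

lemma cell_bounds:
  assumes "z \<in> cell L e" "e \<in> {1..N}" "4 * L * N \<le> p"
  shows "0 \<le> z" "2 * z < p"
proof -
  have L: "L > 0" using assms(1) unfolding cell_def by auto
  have "L * (e - 1) \<le> L * (N - 1)" "0 \<le> L * (e - 1)" using assms(2) L by auto
  moreover have "2 * (L * (e - 1)) \<le> z" "z < 2 * (L * (e - 1)) + L"
    using assms(1) unfolding cell_def by (auto simp: mult.assoc)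
  moreover have "4 * (L * (N - 1)) + 4 * L \<le> p" using assms(3) by (simp add: algebra_simps)
  ultimately show "0 \<le> z" "2 * z < p" using L by linarith+
qed

text \<open>The gaps of length \<open>L\<close> between cells absorb the carries, and \<open>4 * L * N \<le> p\<close> excludes
  wrap-around modulo \<open>p\<close>.\<close>

lemma cell_second_difference:
  assumes "u \<in> cell L a" "v \<in> cell L b" "w \<in> cell L c"
    and "p dvd u + w - 2 * v" "4 * L * N \<le> p"
    and "a \<in> {1..N}" "b \<in> {1..N}" "c \<in> {1..N}"
  shows "a + c = 2 * b"
proof -
  have L: "L > 0" using assms(1) unfolding cell_def by auto
  have "\<bar>u + w - 2 * v\<bar> < p" using cell_bounds[OF assms(1,6,5)] cell_bounds[OF assms(2,7,5)] cell_bounds[OF assms(3,8,5)]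
    by linarith
  with assms(4) have "u + w - 2 * v = 0" by (metis dvd_imp_le_int abs_ge_self linorder_not_less order_le_less_trans)
  \<comment> \<open>With offsets in \<open>[0, L)\<close> from the cell starts,
    \<open>2 * L * (a + c - 2 * b)\<close> equals twice the offset of \<open>v\<close> minus those
    of \<open>u\<close> and \<open>w\<close>, hence lies strictly between \<open>- 2 * L\<close> and
    \<open>2 * L\<close>.\<close>
  then have "L * (2 * (a + c - 2 * b)) < L * 2" "L * (2 * (2 * b - a - c)) < L * 2"
    using assms(1-3) unfolding cell_def by (auto simp: algebra_simps)
  with L have "2 * (a + c - 2 * b) < 2" "2 * (2 * b - a - c) < 2"
    by (simp_all only: mult_less_cancel_left_pos)
  then show ?thesis by presburger
qed

text \<open>\<open>X\<close> is the part of \<open>B\<close> landing in the cells of an AP-free set under \<open>x \<mapsto> t x + s\<close>,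
  and \<open>D\<close> collects the pairs that collide in one cell.\<close>

lemma f_ap_ge_affine_image:
  fixes B A :: "int set" and p t s L N :: int
  assumes k: "k \<ge> 3" and B: "finite B" and A: "A \<subseteq> {1..N}" "ap_free k A"
    and p: "p > 0" "4 * L * N \<le> p"
  defines "y \<equiv> \<lambda>x. (t * x + s) mod p"
  defines "X \<equiv> {x \<in> B. y x \<in> (\<Union>a\<in>A. cell L a)}"
  defines "D \<equiv> {(x, x') \<in> B \<times> B. x < x' \<and> (y x, y x') \<in> (\<Union>a\<in>A. cell L a \<times> cell L a)}"
  shows "card X \<le> f_ap k B + card D"
proof -
  have fin: "finite X" "finite D"
    using B unfolding X_def D_def by (auto intro: finite_subset[of _ "B \<times> B"])
  \<comment> \<open>Removing the smaller point of every colliding pair leaves at most one point in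
    each cell.\<close>
  let ?C = "X - fst ` D"
  have "ap_free k ?C"
  proof (subst ap_free_iff, use k in simp, intro allI impI, rule ccontr)
    fix a d assume C: "\<forall>i<k. a + int i * d \<in> ?C" and d: "d \<noteq> 0"
    let ?x = "\<lambda>i. a + int i * d"
    from C have "\<forall>i<k. \<exists>c\<in>A. y (?x i) \<in> cell L c" unfolding X_def by auto
    then obtain c where c: "\<And>i. i < k \<Longrightarrow> c i \<in> A \<and> y (?x i) \<in> cell L (c i)" by metis
    have "c i + c (i + 2) = 2 * c (i + 1)" if "i + 2 < k" for i
    proof (rule cell_second_difference[where u = "y (?x i)" and v = "y (?x (i+1))" and w = "y (?x (i+2))" and p = p])
      have "(y (?x i) + y (?x (i + 2)) - 2 * y (?x (i + 1))) mod p
        = ((t * ?x i + s) + (t * ?x (i + 2) + s) - 2 * (t * ?x (i + 1) + s)) mod p"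
        unfolding y_def by (intro mod_diff_cong mod_add_cong mod_mult_cong) simp_all
      also have "\<dots> = 0" by (simp add: algebra_simps)
      finally show "p dvd y (?x i) + y (?x (i + 2)) - 2 * y (?x (i + 1))" by (rule mod_0_imp_dvd)
    qed (use c[of i] c[of "i + 1"] c[of "i + 2"] that A p in auto)
    \<comment> \<open>The indices of the cells form a progression inside the AP-free set
      \<open>A\<close>, so it is constant. Two points of \<open>?C\<close> then share a cell, which
      the deletion has ruled out.\<close>
    from second_difference_zero_imp_ap[where k = k and c = c, OF this]
    have "\<forall>i<k. c 0 + int i * (c 1 - c 0) \<in> A" using c by metis
    moreover have "\<And>a d. \<forall>i<k. a + int i * d \<in> A \<Longrightarrow> d = 0"
      using ap_free_iff[of k A] A(2) k by auto
    ultimately have "c 1 - c 0 = 0" by blast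
    then have same: "y (?x 0) \<in> cell L (c 0)" "y (?x 1) \<in> cell L (c 0)" "c 0 \<in> A"
      using c[of 0] c[of 1] k by auto
    have xC: "?x 0 \<in> ?C" "?x 1 \<in> ?C" using C[rule_format, of 0] C[rule_format, of 1] k by simp_all
    then have xB: "?x 0 \<in> B" "?x 1 \<in> B" unfolding X_def by auto
    have "(?x 0, ?x 1) \<in> D \<or> (?x 1, ?x 0) \<in> D"
      using same xB d unfolding D_def by (cases "d > 0") auto
    then have "?x 0 \<in> fst ` D \<or> ?x 1 \<in> fst ` D" by force
    with xC show False by auto
  qed
  then have "card ?C \<le> f_ap k B" using B by (intro card_le_f_ap) (auto simp: X_def)
  moreover have "card X - card (fst ` D) \<le> card ?C" using fin by (intro diff_card_le_card_Diff) auto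
  moreover have "card (fst ` D) \<le> card D" using fin by (intro card_image_le)
  ultimately show ?thesis by linarith
qed

lemma card_cells:
  assumes "finite A" "L \<ge> 0"
  shows "card (\<Union>a\<in>A. cell L a) = card A * nat L"
    and "card (\<Union>a\<in>A. cell L a \<times> cell L a) = card A * (nat L)\<^sup>2"
proof -
  have c: "card (cell L a) = nat L" "finite (cell L a)" for a unfolding cell_def using assms by simp_all
  have "card (\<Union>a\<in>A. cell L a) = (\<Sum>a\<in>A. card (cell L a))"
    using assms c cell_unique by (intro card_UN_disjoint) blast+
  then show "card (\<Union>a\<in>A. cell L a) = card A * nat L" using c by simp
  have "card (\<Union>a\<in>A. cell L a \<times> cell L a) = (\<Sum>a\<in>A. card (cell L a \<times> cell L a))"
    using assms c cell_unique by (intro card_UN_disjoint) blast+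
  then show "card (\<Union>a\<in>A. cell L a \<times> cell L a) = card A * (nat L)\<^sup>2"
    using c by (simp add: card_cartesian_product power2_eq_square)
qed

lemma sum_card_swap:
  assumes "finite T" "finite B"
  shows "(\<Sum>z\<in>T. card {x \<in> B. R z x}) = (\<Sum>x\<in>B. card {z \<in> T. R z x})"
proof -
  have "(\<Sum>z\<in>T. card {x \<in> B. R z x}) = (\<Sum>z\<in>T. \<Sum>x\<in>B. if R z x then 1 else 0)"
    by (simp only: card_eq_sum sum.inter_filter[OF assms(2)])
  also have "\<dots> = (\<Sum>x\<in>B. \<Sum>z\<in>T. if R z x then 1 else 0)" by (rule sum.swap)
  also have "\<dots> = (\<Sum>x\<in>B. card {z \<in> T. R z x})"
    by (simp only: card_eq_sum sum.inter_filter[OF assms(1)])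
  finally show ?thesis .
qed

text \<open>Sum \<open>f_ap_ge_affine_image\<close> over all pairs \<open>(t, s)\<close>. The left
  side is the exact total of \<open>card X\<close>; the last term bounds the total number of
  collisions, with \<open>(card B)\<^sup>2\<close> for the number of pairs.\<close>

lemma f_ap_ge_average:
  fixes B A :: "int set" and p L N :: int
  assumes k: "k \<ge> 3" and B: "finite B" and A: "A \<subseteq> {1..N}" "ap_free k A"
    and p: "prime p" "4 * L * N \<le> p" "L \<ge> 0"
    and sep: "\<And>x x'. x \<in> B \<Longrightarrow> x' \<in> B \<Longrightarrow> x \<noteq> x' \<Longrightarrow> \<not> p dvd x - x'"
  shows "card B * nat p * (card A * nat L) \<le> (nat p)\<^sup>2 * f_ap k B + (card B)\<^sup>2 * (card A * (nat L)\<^sup>2)"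
proof -
  have p0: "p > 0" using p(1) by (simp add: prime_gt_0_int)
  have finA: "finite A" using A(1) finite_subset by blast
  let ?T = "{0..<p} \<times> {0..<p}"
  let ?S = "\<Union>a\<in>A. cell L a" and ?P = "\<Union>a\<in>A. cell L a \<times> cell L a"
  let ?y = "\<lambda>z x. (fst z * x + snd z) mod p"
  have sub: "cell L a \<subseteq> {0..<p}" if "a \<in> A" for a using cell_bounds[OF _ _ p(2)] that A(1) by fastforce
  have single: "card {z \<in> ?T. ?y z x \<in> ?S} = nat p * (card A * nat L)" for x
  proof -
    have "{z \<in> ?T. ?y z x \<in> ?S} = {(t,s). t \<in> {0..<p} \<and> s \<in> {0..<p} \<and> (t * x + s) mod p \<in> ?S}" by auto
    then show ?thesis using card_affine_preimage[of p ?S x] p0 sub card_cells(1)[OF finA p(3)] by (simp add: UN_subset_iff)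
  qed
  have pair: "card {z \<in> ?T. (?y z x, ?y z x') \<in> ?P} = card A * (nat L)\<^sup>2" if "x \<in> B" "x' \<in> B" "x < x'" for x x'
  proof -
    have "?P \<subseteq> ?T" using sub by blast
    then have "card {(t,s). t \<in> {0..<p} \<and> s \<in> {0..<p} \<and> ((t * x + s) mod p, (t * x' + s) mod p) \<in> ?P} = card ?P"
      using card_affine_preimage_pair[of p x x' ?P] p(1) sep[of x x'] that by blast
    moreover have "{z \<in> ?T. (?y z x, ?y z x') \<in> ?P}
      = {(t,s). t \<in> {0..<p} \<and> s \<in> {0..<p} \<and> ((t * x + s) mod p, (t * x' + s) mod p) \<in> ?P}" by auto
    ultimately show ?thesis using card_cells(2)[OF finA p(3)] by simp
  qed
  let ?Q = "{w \<in> B \<times> B. fst w < snd w}"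
  have finQ: "finite ?Q" using B by auto
  have "card {x \<in> B. ?y z x \<in> ?S} \<le> f_ap k B + card {w \<in> ?Q. (?y z (fst w), ?y z (snd w)) \<in> ?P}" for z
  proof -
    have "{w \<in> ?Q. (?y z (fst w), ?y z (snd w)) \<in> ?P}
      = {(x, x') \<in> B \<times> B. x < x' \<and> (?y z x, ?y z x') \<in> ?P}" by auto
    then show ?thesis using f_ap_ge_affine_image[OF k B A p0 p(2), of "fst z" "snd z"] by simp
  qed
  then have "(\<Sum>z\<in>?T. card {x \<in> B. ?y z x \<in> ?S})
    \<le> (\<Sum>z\<in>?T. f_ap k B + card {w \<in> ?Q. (?y z (fst w), ?y z (snd w)) \<in> ?P})" by (intro sum_mono)
  moreover have "(\<Sum>z\<in>?T. card {x \<in> B. ?y z x \<in> ?S}) = card B * (nat p * (card A * nat L))"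
    by (subst sum_card_swap) (use B single in simp_all)
  moreover have "(\<Sum>z\<in>?T. card {w \<in> ?Q. (?y z (fst w), ?y z (snd w)) \<in> ?P}) = card ?Q * (card A * (nat L)\<^sup>2)"
  proof -
    have "(\<Sum>z\<in>?T. card {w \<in> ?Q. (?y z (fst w), ?y z (snd w)) \<in> ?P})
      = (\<Sum>w\<in>?Q. card {z \<in> ?T. (?y z (fst w), ?y z (snd w)) \<in> ?P})"
      using finQ by (intro sum_card_swap) auto
    also have "\<dots> = (\<Sum>w\<in>?Q. card A * (nat L)\<^sup>2)" by (intro sum.cong refl pair) auto
    finally show ?thesis by simp
  qed
  moreover have "card ?Q \<le> (card B)\<^sup>2"
    using card_mono[of "B \<times> B" ?Q] B by (auto simp: card_cartesian_product power2_eq_square)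
  then have "card ?Q * (card A * (nat L)\<^sup>2) \<le> (card B)\<^sup>2 * (card A * (nat L)\<^sup>2)" by (intro mult_right_mono) auto
  ultimately have "card B * (nat p * (card A * nat L)) \<le> card ?T * f_ap k B + (card B)\<^sup>2 * (card A * (nat L)\<^sup>2)"
    by (simp only: sum.distrib sum_constant of_nat_id)
  then show ?thesis by (simp add: card_cartesian_product power2_eq_square algebra_simps)
qed

text \<open>Take an optimal \<open>A\<close> and cells of length \<open>p div (4 * N)\<close>. As
  the prime \<open>p\<close> grows, a cell covers a proportion of the residues tending to
  \<open>1 / (4 * N)\<close>, and the rounding error disappears.\<close>

lemma f_ap_lower_bound:
  fixes B :: "int set" and N :: nat
  assumes k: "k \<ge> 3" and B: "finite B" and N: "N \<ge> 1" "card B \<le> N"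
  shows "real (card B) * real (g_ap k N) / (4 * real N) * (1 - real (card B) / (4 * real N)) \<le> real (f_ap k B)"
proof -
  define n where "n = real (card B)"
  obtain A where A: "A \<subseteq> {1..int N}" "ap_free k A" "card A = g_ap k N"
    unfolding g_ap_def using f_ap_attained[of "{1..int N}" k] by auto
  define a where "a = real (card A)"
  define \<theta> where "\<theta> = 1 - n / (4 * real N)"
  have th: "0 \<le> \<theta>" "\<theta> \<le> 1" unfolding \<theta>_def n_def using N by (auto simp: field_simps)
  \<comment> \<open>The size condition on \<open>p\<close> keeps the points of \<open>B\<close>
    distinct modulo \<open>p\<close>; the term \<open>1 / p\<close> pays for rounding the cell
    length down.\<close>
  have bound: "n * a * (1 / (4 * N) - 1 / p) * \<theta> \<le> f_ap k B"
    if p: "prime p" "real p > 2 * (\<Sum>x\<in>B. \<bar>x\<bar>)" for p :: nat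
  proof -
    have p0: "p > 0" using p by (simp add: prime_gt_0_nat)
    define L where "L = p div (4 * N)"
    have sep: "\<not> int p dvd x - x'" if x: "x \<in> B" "x' \<in> B" "x \<noteq> x'" for x x'
    proof
      assume "int p dvd x - x'"
      then have "int p \<le> \<bar>x - x'\<bar>" using x by (metis dvd_imp_le_int eq_iff_diff_eq_0 abs_of_nat)
      also have "\<dots> \<le> (\<Sum>x\<in>B. \<bar>x\<bar>) + (\<Sum>x\<in>B. \<bar>x\<bar>)"
        using member_le_sum[of x B abs] member_le_sum[of x' B abs] x B by auto
      finally show False using p(2) by linarith
    qed
    have "4 * L * N \<le> p" unfolding L_def by (metis div_times_less_eq_dividend mult.assoc mult.commute)
    then have LN: "4 * int L * int N \<le> int p" by (metis of_nat_le_iff of_nat_mult of_nat_numeral)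
    have "card B * p * (card A * L) \<le> p\<^sup>2 * f_ap k B + (card B)\<^sup>2 * (card A * L\<^sup>2)"
      using f_ap_ge_average[OF k B A(1,2), of "int p" "int L"] p(1) LN sep by simp
    then have "real (card B * p * (card A * L)) \<le> real (p\<^sup>2 * f_ap k B + (card B)\<^sup>2 * (card A * L\<^sup>2))"
      by (simp only: of_nat_le_iff)
    then have main: "n * p * (a * L) \<le> (real p)\<^sup>2 * f_ap k B + n\<^sup>2 * (a * (real L)\<^sup>2)" by (simp add: n_def a_def)
    define \<rho> where "\<rho> = real L / real p"
    have l: "real L = \<rho> * p" unfolding \<rho>_def using p0 by simp
    from main have "(real p)\<^sup>2 * (n * a * \<rho> * (1 - n * \<rho>)) \<le> (real p)\<^sup>2 * f_ap k B"
      unfolding l by (simp add: algebra_simps power2_eq_square)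
    then have f: "n * a * \<rho> * (1 - n * \<rho>) \<le> f_ap k B" using p0 by simp
    have lu: "\<rho> \<le> 1 / (4 * N)" unfolding \<rho>_def using LN p0 N
      by (simp add: field_simps) (metis of_nat_le_iff of_nat_mult of_nat_numeral \<open>4 * L * N \<le> p\<close> mult.commute mult.left_commute)
    have "p < 4 * N * L + 4 * N" unfolding L_def using N
      by (metis dividend_less_div_times add.commute mult.commute nat_0_less_mult_iff zero_less_numeral less_le_trans zero_less_one)
    then have "real p < 4 * N * L + 4 * N" by (metis of_nat_less_iff)
    then have "real p / (4 * N) \<le> real L + 1" using N by (simp add: pos_divide_le_eq algebra_simps)
    then have "real p / (4 * N) / p \<le> (real L + 1) / p" by (intro divide_right_mono) auto
    then have ll: "1 / (4 * N) - 1 / p \<le> \<rho>" unfolding \<rho>_def using p0 by (simp add: add_divide_distrib)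
    have "n * \<rho> \<le> n / (4 * N)" using mult_left_mono[OF lu, of n] by (simp add: n_def)
    then have "\<theta> \<le> 1 - n * \<rho>" unfolding \<theta>_def by simp
    moreover have "n * a * (1 / (4 * N) - 1 / p) \<le> n * a * \<rho>" using ll by (intro mult_left_mono) (auto simp: n_def a_def)
    moreover have "0 \<le> n * a * \<rho>" by (simp add: n_def a_def \<rho>_def)
    ultimately have "n * a * (1 / (4 * N) - 1 / p) * \<theta> \<le> n * a * \<rho> * (1 - n * \<rho>)"
      using th by (meson mult_left_mono mult_right_mono order_trans)
    with f show ?thesis by linarith
  qed
  have "n * a / (4 * N) * \<theta> \<le> f_ap k B"
  proof (rule ccontr)
    assume neg: "\<not> ?thesis"
    define e where "e = n * a / (4 * N) * \<theta> - f_ap k B"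
    have e: "e > 0" unfolding e_def using neg by simp
    \<comment> \<open>In place of a limit: once \<open>p\<close> exceeds \<open>n * a / e\<close>,
      the rounding error is smaller than the supposed deficit \<open>e\<close>.\<close>
    obtain p :: nat where p: "prime p" "p > nat \<lceil>max (n * a / e) (2 * (\<Sum>x\<in>B. \<bar>x\<bar>))\<rceil>" using bigger_prime by blast
    then have "real p > max (n * a / e) (2 * (\<Sum>x\<in>B. \<bar>x\<bar>))" by linarith
    then have p': "real p > n * a / e" "real p > 2 * (\<Sum>x\<in>B. \<bar>x\<bar>)" by auto
    have p0: "real p > 0" using p by (simp add: prime_gt_0_nat)
    have "n * a / p < e" using p'(1) e p0 by (simp add: field_simps)
    moreover have "n * a / p * \<theta> \<le> n * a / p" using th by (intro mult_left_le) (auto simp: n_def a_def)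
    ultimately show False using bound[OF p(1) p'(2)] unfolding e_def by (simp add: algebra_simps)
  qed
  then show ?thesis unfolding n_def a_def \<theta>_def A(3) by simp
qed

subsection \<open>Behrend's lower bound\<close>

lemma digits_unique:
  fixes a c :: "nat \<Rightarrow> nat"
  assumes "\<And>i. i < m \<Longrightarrow> a i < b" "\<And>i. i < m \<Longrightarrow> c i < b"
    and "(\<Sum>i<m. a i * b ^ i) = (\<Sum>i<m. c i * b ^ i)"
  shows "i < m \<Longrightarrow> a i = c i"
  using assms
proof (induction m arbitrary: a c i)
  case (Suc m)
  have split: "(\<Sum>i<Suc m. e i * b ^ i) = e 0 + b * (\<Sum>i<m. e (Suc i) * b ^ i)" for e :: "nat \<Rightarrow> nat"
    by (simp only: sum.lessThan_Suc_shift) (simp add: sum_distrib_left mult_ac)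
  have eq: "a 0 + b * (\<Sum>i<m. a (Suc i) * b ^ i) = c 0 + b * (\<Sum>i<m. c (Suc i) * b ^ i)"
    using Suc.prems(4) by (simp only: split)
  have lt: "a 0 < b" "c 0 < b" using Suc.prems by auto
  have a0: "a 0 = c 0" using arg_cong[OF eq, of "\<lambda>x. x mod b"] lt by simp
  with eq lt have "(\<Sum>i<m. a (Suc i) * b ^ i) = (\<Sum>i<m. c (Suc i) * b ^ i)" by simp
  then have "a (Suc j) = c (Suc j)" if "j < m" for j
    using Suc.IH[of j "\<lambda>i. a (Suc i)" "\<lambda>i. c (Suc i)"] Suc.prems that by auto
  with a0 Suc.prems(1) show ?case by (cases i) auto
qed simp

lemma digits_less:
  fixes a :: "nat \<Rightarrow> nat"
  assumes "\<And>i. i < m \<Longrightarrow> a i < b"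
  shows "(\<Sum>i<m. a i * b ^ i) < b ^ m"
  using assms
proof (induction m)
  case (Suc m)
  have "(\<Sum>i<m. a i * b ^ i) < b ^ m" using Suc by auto
  moreover have "Suc (a m) * b ^ m \<le> b * b ^ m" using Suc.prems[of m] by (intro mult_right_mono) auto
  ultimately show ?case by simp
qed simp

text \<open>By the parallelogram law the squared distance of \<open>u\<close> and \<open>w\<close>
  is \<open>2 * R + 2 * R - 4 * R = 0\<close>.\<close>

lemma midpoint_on_sphere_eq:
  fixes u v w :: "nat \<Rightarrow> nat"
  assumes "\<And>i. i < m \<Longrightarrow> u i + w i = 2 * v i"
    and "(\<Sum>i<m. (u i)\<^sup>2) = R" "(\<Sum>i<m. (v i)\<^sup>2) = R" "(\<Sum>i<m. (w i)\<^sup>2) = R"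
  shows "i < m \<Longrightarrow> u i = w i"
proof -
  have "(int (u i) - int (w i))\<^sup>2 = 2 * (int (u i))\<^sup>2 + 2 * (int (w i))\<^sup>2 - 4 * (int (v i))\<^sup>2" if "i < m" for i
  proof -
    have "int (u i) + int (w i) = 2 * int (v i)" using assms(1)[OF that] by linarith
    then have "(int (u i) + int (w i))\<^sup>2 = 4 * (int (v i))\<^sup>2" by (simp add: power_mult_distrib)
    then show ?thesis by (simp add: power2_eq_square algebra_simps)
  qed
  then have "(\<Sum>i<m. (int (u i) - int (w i))\<^sup>2)
    = (\<Sum>i<m. 2 * (int (u i))\<^sup>2 + 2 * (int (w i))\<^sup>2 - 4 * (int (v i))\<^sup>2)" by (intro sum.cong) auto
  also have "\<dots> = 2 * (\<Sum>i<m. (int (u i))\<^sup>2) + 2 * (\<Sum>i<m. (int (w i))\<^sup>2) - 4 * (\<Sum>i<m. (int (v i))\<^sup>2)"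
    by (simp add: sum.distrib sum_subtractf sum_distrib_left)
  also have "\<dots> = 2 * int R + 2 * int R - 4 * int R"
    using assms(2-4)[THEN arg_cong, of int] by simp
  finally have "(\<Sum>i<m. (int (u i) - int (w i))\<^sup>2) = 0" by simp
  then have "\<forall>i\<in>{..<m}. (int (u i) - int (w i))\<^sup>2 = 0" by (subst (asm) sum_nonneg_eq_0_iff) auto
  then show "i < m \<Longrightarrow> u i = w i" by auto
qed

text \<open>Behrend's construction: base-\<open>2d\<close> digits below \<open>d\<close> add without carries, so a progression of
  numbers is a progression of digit vectors, and a sphere contains no midpoints.\<close>

lemma behrend_sphere:
  assumes k: "k \<ge> 3" and d: "d \<ge> 1"
  shows "card {v \<in> {..<m} \<rightarrow>\<^sub>E {..<d}. (\<Sum>i<m. (v i)\<^sup>2) = R} \<le> g_ap k ((2 * d) ^ m)"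
proof -
  let ?F = "{v \<in> {..<m} \<rightarrow>\<^sub>E {..<d}. (\<Sum>i<m. (v i)\<^sup>2) = R}"
  let ?val = "\<lambda>v :: nat \<Rightarrow> nat. \<Sum>i<m. v i * (2 * d) ^ i"
  \<comment> \<open>The shift by 1 moves the values from 0 up to \<open>(2 * d) ^ m - 1\<close> into
    the interval \<open>{1..(2 * d) ^ m}\<close>.\<close>
  let ?h = "\<lambda>v. int (?val v) + 1"
  have dig: "v i < d" if "v \<in> ?F" "i < m" for v i using that by (auto simp: PiE_iff)
  have dig2: "v i < 2 * d" if "v \<in> ?F" "i < m" for v i using dig[OF that] by simp
  have ext: "v = w" if "v \<in> ?F" "w \<in> ?F" "\<And>i. i < m \<Longrightarrow> v i = w i" for v w
    using that by (intro PiE_ext[of v "{..<m}" "\<lambda>_. {..<d}" w]) auto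
  have "inj_on ?h ?F"
  proof (rule inj_onI)
    fix v w assume vw: "v \<in> ?F" "w \<in> ?F" "?h v = ?h w"
    then have "?val v = ?val w" by (simp only: add_right_cancel of_nat_eq_iff)
    from digits_unique[OF dig2[OF vw(1)] dig2[OF vw(2)] this] show "v = w" using ext vw by blast
  qed
  moreover have "?h ` ?F \<subseteq> {1..int ((2 * d) ^ m)}"
  proof (rule image_subsetI)
    fix v assume "v \<in> ?F"
    from digits_less[OF dig2[OF this]] have "?val v < (2 * d) ^ m" .
    then have "int (?val v) < int ((2 * d) ^ m)" by (simp only: of_nat_less_iff)
    then show "?h v \<in> {1..int ((2 * d) ^ m)}" by (simp only: atLeastAtMost_iff) linarith
  qed
  moreover have "ap_free k (?h ` ?F)"
  proof (subst ap_free_iff, use k in simp, intro allI impI)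
    fix a e assume ap: "\<forall>i<k. a + int i * e \<in> ?h ` ?F"
    \<comment> \<open>As \<open>k \<ge> 3\<close>, the first three terms are available, and they
      already force \<open>e = 0\<close>.\<close>
    have "a + int 0 * e \<in> ?h ` ?F" "a + int 1 * e \<in> ?h ` ?F" "a + int 2 * e \<in> ?h ` ?F"
      using ap k by (intro ap[rule_format]; simp)+
    then obtain u v w where uvw: "u \<in> ?F" "v \<in> ?F" "w \<in> ?F"
      and h: "a = ?h u" "a + e = ?h v" "a + 2 * e = ?h w" by auto
    have "?h u + ?h w = 2 * ?h v" unfolding h[symmetric] by simp
    moreover have "x + z = 2 * y" if "int x + 1 + (int z + 1) = 2 * (int y + 1)" for x y z
      using that by presburger
    ultimately have "?val u + ?val w = 2 * ?val v" by blast
    then have "(\<Sum>i<m. (u i + w i) * (2 * d) ^ i) = (\<Sum>i<m. (2 * v i) * (2 * d) ^ i)"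
      by (simp add: sum.distrib sum_distrib_left algebra_simps)
    \<comment> \<open>Both sides are digits below the base \<open>2 * d\<close>, so the expansions
      can be compared digit by digit.\<close>
    then have "u i + w i = 2 * v i" if "i < m" for i
      using digits_unique[of m "\<lambda>i. u i + w i" "2 * d" "\<lambda>i. 2 * v i" i] dig uvw that by (metis (no_types, lifting) add_less_mono mult_2 mult_less_cancel1 zero_less_numeral)
    with uvw have "u i = w i" if "i < m" for i using midpoint_on_sphere_eq[of m u w v R i] that by auto
    then have "u = w" using ext uvw by blast
    then show "e = 0" using h by simp
  qed
  ultimately have "card (?h ` ?F) \<le> g_ap k ((2 * d) ^ m)"
    unfolding g_ap_def by (intro card_le_f_ap) auto
  then show ?thesis using \<open>inj_on ?h ?F\<close> by (simp only: card_image)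
qed

text \<open>Pigeonhole: the \<open>d ^ m\<close> digit vectors lie on \<open>m * d\<^sup>2\<close>
  spheres, one for each squared radius below \<open>m * d\<^sup>2\<close>.\<close>

lemma behrend:
  assumes k: "k \<ge> 3" and d: "d \<ge> 1" and m: "m \<ge> 1"
  shows "d ^ m \<le> m * d\<^sup>2 * g_ap k ((2 * d) ^ m)"
proof -
  let ?F = "{..<m} \<rightarrow>\<^sub>E {..<d}"
  have "(\<Sum>i<m. (v i)\<^sup>2) < m * d\<^sup>2" if "v \<in> ?F" for v
  proof -
    have "(\<Sum>i<m. (v i)\<^sup>2) < (\<Sum>i<m. d\<^sup>2)"
      using that m by (intro sum_strict_mono) (auto simp: PiE_iff power_strict_mono lessThan_empty_iff)
    then show ?thesis by simp
  qed
  then have "?F \<subseteq> (\<Union>R<m * d\<^sup>2. {v \<in> ?F. (\<Sum>i<m. (v i)\<^sup>2) = R})" by blast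
  then have "card ?F \<le> card (\<Union>R<m * d\<^sup>2. {v \<in> ?F. (\<Sum>i<m. (v i)\<^sup>2) = R})"
    by (intro card_mono) (auto simp: finite_PiE)
  also have "\<dots> \<le> (\<Sum>R<m * d\<^sup>2. card {v \<in> ?F. (\<Sum>i<m. (v i)\<^sup>2) = R})" by (rule card_UN_le) simp
  also have "\<dots> \<le> (\<Sum>R<m * d\<^sup>2. g_ap k ((2 * d) ^ m))" by (intro sum_mono behrend_sphere k d)
  finally show ?thesis by (simp add: card_PiE)
qed

lemma g_ap_mono:
  assumes "m \<le> n"
  shows "g_ap k m \<le> g_ap k n"
proof -
  obtain A where "A \<subseteq> {1..int m}" "ap_free k A" "card A = g_ap k m"
    unfolding g_ap_def using f_ap_attained[of "{1..int m}" k] by auto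
  then show ?thesis unfolding g_ap_def[of k n] using assms card_le_f_ap[of "{1..int n}" A k] by fastforce
qed

text \<open>Use \<open>behrend\<close> with \<open>m = q\<close> and \<open>d = 2 ^ q\<close>, where
  \<open>q\<close> is the largest number with \<open>2 ^ (q * (q + 1)) \<le> N\<close>. Balancing
  dimension against digit size gives the square root in the exponent.\<close>

lemma behrend_bound:
  assumes k: "k \<ge> 3" and N: "N \<ge> 1"
  shows "real N \<le> real (g_ap k N) * 2 powr (6 * sqrt (log 2 N) + 2)"
proof -
  have ex: "\<exists>q. N < 2 ^ ((q + 1) * (q + 2))"
  proof
    have "N < 2 ^ N" by simp
    also have "\<dots> \<le> (2::nat) ^ ((N + 1) * (N + 2))" by (rule power_increasing) auto
    finally show "N < 2 ^ ((N + 1) * (N + 2))" .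
  qed
  define q where "q = (LEAST q. N < 2 ^ ((q + 1) * (q + 2)))"
  have up: "N < 2 ^ ((q + 1) * (q + 2))" unfolding q_def using ex by (rule LeastI_ex)
  have lo: "2 ^ (q * (q + 1)) \<le> N"
  proof (cases q)
    case (Suc r)
    then have "\<not> N < 2 ^ ((r + 1) * (r + 2))" using not_less_Least[of r "\<lambda>q. N < 2 ^ ((q + 1) * (q + 2))"] unfolding q_def by simp
    then show ?thesis using Suc by simp
  qed (use N in simp)
  \<comment> \<open>Behrend loses \<open>2 ^ (3 * q)\<close>, using \<open>q \<le> 2 ^ q\<close>,
    and rounding \<open>N\<close> down to the scale loses \<open>2 ^ (3 * q + 2)\<close>. The case
    \<open>q = 0\<close> is separate because \<open>behrend\<close> needs positive
    dimension.\<close>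
  have main: "N \<le> g_ap k N * 2 ^ (6 * q + 2)"
  proof (cases "q = 0")
    case True
    then have "N \<le> 1 * 4" using up by simp
    also have "\<dots> \<le> g_ap k N * 4" using g_ap_pos[of k N] k N by (intro mult_right_mono) auto
    finally show ?thesis using True by simp
  next
    case False
    have "(2 * 2 ^ q :: nat) ^ q = 2 ^ (q * (q + 1))"
      by (metis mult.commute power_Suc power_mult Suc_eq_plus1)
    then have "g_ap k ((2 * 2 ^ q) ^ q) \<le> g_ap k N" using lo by (intro g_ap_mono) simp
    then have "(2 ^ q) ^ q \<le> q * (2 ^ q)\<^sup>2 * g_ap k N"
      using behrend[OF k, of "2 ^ q" q] False by (auto elim!: order_trans)
    also have "\<dots> \<le> 2 ^ q * (2 ^ q)\<^sup>2 * g_ap k N" by (intro mult_right_mono) (auto simp: less_imp_le)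
    finally have b: "2 ^ (q * q) \<le> 2 ^ (3 * q) * g_ap k N"
      by (simp add: power_mult[symmetric] power_add[symmetric] mult.commute numeral_eq_Suc)
    have "(q + 1) * (q + 2) = q * q + (3 * q + 2)" by (simp add: algebra_simps)
    then have "N \<le> 2 ^ (q * q) * 2 ^ (3 * q + 2)" using up by (metis less_imp_le power_add)
    also have "\<dots> \<le> 2 ^ (3 * q) * g_ap k N * 2 ^ (3 * q + 2)" using b by (rule mult_right_mono) simp
    also have "\<dots> = g_ap k N * (2 ^ (3 * q) * 2 ^ (3 * q + 2))" by (simp only: mult_ac)
    also have "2 ^ (3 * q) * 2 ^ (3 * q + 2) = (2::nat) ^ (6 * q + 2)" by (simp only: power_add[symmetric]) simp
    finally show ?thesis .
  qed
  have "real (q * q) \<le> log 2 N"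
  proof -
    have "2 ^ (q * q) \<le> (2::nat) ^ (q * (q + 1))" by (rule power_increasing) auto
    with lo have "2 ^ (q * q) \<le> N" by linarith
    then have "2 powr real (q * q) \<le> real N"
      by (simp only: powr_realpow zero_less_numeral numeral_power_le_of_nat_cancel_iff)
    then show ?thesis using N by (simp add: le_log_iff)
  qed
  then have "real q \<le> sqrt (log 2 N)" by (intro real_le_rsqrt) (simp add: power2_eq_square)
  then have "2 powr real (6 * q + 2) \<le> 2 powr (6 * sqrt (log 2 N) + 2)" by simp
  moreover have "real N \<le> real (g_ap k N) * 2 powr real (6 * q + 2)"
  proof -
    have "real N \<le> real (g_ap k N * 2 ^ (6 * q + 2))" using main by (simp only: of_nat_le_iff)
    then show ?thesis by (simp only: powr_realpow zero_less_numeral of_nat_mult of_nat_power of_nat_numeral)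
  qed
  ultimately show ?thesis by (meson mult_left_mono of_nat_0_le_iff order_trans)
qed

subsection \<open>Scales at which the density is nearly constant\<close>

text \<open>This is \<open>f_ap_lower_bound\<close> with \<open>N = n * H\<close> at a minimising
  \<open>B\<close>; enlarging \<open>N\<close> by \<open>H\<close> reduces the collision loss to
  \<open>1 / (4 * H)\<close>.\<close>

lemma phi_ap_lower_bound:
  assumes "k \<ge> 3" "n \<ge> 1" "H \<ge> 1"
  shows "real (g_ap k (n * H)) / (4 * real H) * (1 - 1 / (4 * real H)) \<le> real (phi_ap k n)"
proof -
  obtain B where B: "finite B" "card B = n" "phi_ap k n = f_ap k B" by (rule phi_ap_attained)
  have "real n * real (g_ap k (n * H)) / (4 * real (n * H)) * (1 - real n / (4 * real (n * H))) \<le> real (phi_ap k n)"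
    using f_ap_lower_bound[OF assms(1) B(1), of "n * H"] B assms by simp
  then show ?thesis using assms by simp
qed

text \<open>If the density \<open>g_ap k m / m\<close> lost a factor \<open>1 - 1 / H\<close> at each of the \<open>j\<close> steps
  \<open>m \<mapsto> m * H\<close>, it would fall below Behrend's bound.\<close>

lemma density_nearly_constant_step:
  fixes n H j k :: nat
  assumes k: "k \<ge> 3" and n: "n \<ge> 1" and H: "H \<ge> 1"
    and j: "ln 2 * (6 * sqrt (log 2 (n * H ^ j)) + 2) < j / H"
  defines "r \<equiv> \<lambda>i. real (g_ap k (n * H ^ i)) / real (n * H ^ i)"
  shows "\<exists>i<j. (1 - 1 / H) * r i \<le> r (Suc i)"
proof (rule ccontr)
  assume "\<not> ?thesis"
  then have dec: "r (Suc i) < (1 - 1 / H) * r i" if "i < j" for i using that by force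
  have h: "0 \<le> 1 - 1 / real H" using H by simp
  have "i \<le> j \<Longrightarrow> r i \<le> (1 - 1 / H) ^ i" for i
  proof (induction i)
    case 0
    show ?case using g_ap_le[of k n] n unfolding r_def by simp
  next
    case (Suc i)
    then have "(1 - 1 / H) * r i \<le> (1 - 1 / H) * (1 - 1 / H) ^ i" using h by (intro mult_left_mono) auto
    with dec[of i] Suc.prems show ?case by simp
  qed
  then have "r j \<le> (1 - 1 / H) ^ j" by simp
  also have "\<dots> \<le> exp (- (1 / H)) ^ j" using h exp_ge_add_one_self[of "- (1 / H)"] by (intro power_mono) auto
  also have "\<dots> = exp (- (j / H))" by (simp add: exp_of_nat_mult[symmetric])
  finally have up: "r j \<le> exp (- (j / H))" .
  let ?N = "n * H ^ j" and ?E = "6 * sqrt (log 2 (n * H ^ j)) + 2"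
  have N: "?N \<ge> 1" using n H by simp
  have "real ?N \<le> real (g_ap k ?N) * 2 powr ?E" using behrend_bound[OF k N] .
  \<comment> \<open>Behrend keeps \<open>r j\<close> at or above \<open>2 powr (- ?E)\<close>, while
    the assumption on \<open>j\<close> puts \<open>exp (- (j / H))\<close> below that.\<close>
  then have "1 \<le> r j * 2 powr ?E" unfolding r_def using N n H by (simp add: field_simps)
  also have "\<dots> \<le> exp (- (j / H)) * 2 powr ?E" using up by (intro mult_right_mono) auto
  also have "\<dots> = exp (ln 2 * ?E - j / H)" by (simp add: powr_def exp_diff exp_minus field_simps)
  also have "\<dots> < 1" using j by simp
  finally show False by simp
qed

section \<open>The good integers and the segments that contain them\<close>

text \<open>At \<open>m = 1\<close> the generic formula has the junk value \<open>ln (ln 1) = 0\<close>; the value \<open>- 1\<close> puts \<open>1\<close>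
  into \<open>good k\<close>, which is forced because the segment of the theorem at \<open>n = 1\<close> is \<open>{1}\<close>.\<close>

definition ap_defect :: "nat \<Rightarrow> real" where
  "ap_defect m = (if m \<le> 1 then - 1 else - 1 / (ln (ln m) - 2))"

text \<open>Its increasing enumeration serves as the sequence of the theorem.\<close>

definition good :: "nat \<Rightarrow> nat set" where
  "good k = {m. m \<ge> 1 \<and> real (phi_ap k m) > (1/4 + ap_defect m) * real (g_ap k m)}"

lemma ap_defect_tendsto_0: "ap_defect \<longlonglongrightarrow> 0"
proof (rule Lim_transform_eventually)
  show "(\<lambda>m::nat. - 1 / (ln (ln (real m)) - 2)) \<longlonglongrightarrow> 0" by real_asymp
  show "\<forall>\<^sub>F m in sequentially. - 1 / (ln (ln (real m)) - 2) = ap_defect m"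
    using eventually_gt_at_top[of 1] by eventually_elim (simp add: ap_defect_def)
qed

lemma one_in_good: "k \<ge> 3 \<Longrightarrow> 1 \<in> good k"
  using g_ap_pos[of k 1] by (simp add: good_def ap_defect_def)

text \<open>With \<open>t = 1 / H\<close>, the density step costs a factor \<open>1 - t\<close> and
  the collisions \<open>1 - t / 4\<close>. Together they lower 1/4 by less than \<open>t\<close>,
  which is at most \<open>1 / (ln (ln m) - 2)\<close>.\<close>

lemma good_if_density_nearly_constant:
  fixes m H k :: nat
  assumes k: "k \<ge> 3" and m: "m \<ge> 2" and H: "H \<ge> 2"
    and step: "(1 - 1 / H) * (real (g_ap k m) / m) \<le> real (g_ap k (m * H)) / real (m * H)"
    and big: "2 < ln (ln m)" "ln (ln m) - 2 \<le> H"
  shows "m \<in> good k"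
proof -
  have g: "real (g_ap k m) > 0" using g_ap_pos[of k m] k m by simp
  define t where "t = 1 / real H"
  have t: "0 < t" "t \<le> 1 / 2" unfolding t_def using H by (auto simp: field_simps)
  have "(1 - t) * real (g_ap k m) \<le> real (g_ap k (m * H)) / H"
  proof -
    have "m * ((1 - 1 / H) * (real (g_ap k m) / m)) \<le> m * (real (g_ap k (m * H)) / real (m * H))"
      using step by (intro mult_left_mono) auto
    then show ?thesis using m unfolding t_def by simp
  qed
  then have "(1 - t) * real (g_ap k m) / 4 * (1 - t / 4) \<le> real (g_ap k (m * H)) / H / 4 * (1 - t / 4)"
    using t by (intro mult_right_mono divide_right_mono) auto
  also have "\<dots> \<le> phi_ap k m"
    using phi_ap_lower_bound[OF k, of m H] m H by (simp add: t_def mult.commute)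
  finally have 1: "(1 - t) * (1 - t / 4) / 4 * real (g_ap k m) \<le> phi_ap k m" by (simp add: mult_ac)
  have "t \<le> 1 / (ln (ln m) - 2)" unfolding t_def using big by (intro divide_left_mono) auto
  moreover have "1 / 4 - t < (1 - t) * (1 - t / 4) / 4"
  proof -
    have "(1 - t) * (1 - t / 4) / 4 = 1 / 4 - 5 * t / 16 + t * t / 16" by (simp add: field_simps)
    moreover have "t * t \<ge> 0" by simp
    ultimately show ?thesis using t by linarith
  qed
  ultimately have "1/4 + ap_defect m < (1 - t) * (1 - t / 4) / 4" unfolding ap_defect_def using m by simp
  then have "(1/4 + ap_defect m) * real (g_ap k m) < (1 - t) * (1 - t / 4) / 4 * real (g_ap k m)"
    using g by (intro mult_strict_right_mono)
  with 1 show ?thesis unfolding good_def using m by simp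
qed

text \<open>With \<open>x = ln n\<close>, take \<open>H\<close> about \<open>ln x\<close> and
  \<open>j\<close> about \<open>H\<^sup>2 * sqrt x\<close>. Then \<open>j / H\<close> is about
  \<open>H * sqrt x\<close>, which beats the Behrend exponent of order \<open>sqrt x\<close>, while
  \<open>H ^ j\<close> still fits into the segment.\<close>

lemma good_in_segment:
  fixes n k :: nat
  assumes k: "k \<ge> 3"
    and n: "ln n \<ge> 4" "ln (ln n) \<ge> 15" "(ln (ln n)) ^ 3 * sqrt (ln n) \<le> ln n"
  shows "\<exists>m\<in>good k. n \<le> m \<and> m \<le> n * exp ((ln (ln n)) ^ 3 * sqrt (ln n))"
proof -
  define x where "x = ln (real n)"
  define H where "H = nat \<lfloor>ln x\<rfloor>"
  define j where "j = nat \<lfloor>(real H)\<^sup>2 * sqrt x\<rfloor>"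
  have n2: "n \<ge> 2"
  proof (rule ccontr)
    assume "\<not> n \<ge> 2"
    then have "n = 0 \<or> n = 1" by auto
    with n(1) show False by auto
  qed
  have x: "x \<ge> 4" using n unfolding x_def by simp
  have Hu: "real H \<le> ln x" and Hl: "ln x - 1 \<le> real H" and H14: "H \<ge> 14"
    using n unfolding H_def x_def by linarith+
  have sx: "sqrt x \<ge> 2" using x by (simp add: real_le_rsqrt)
  have j0: "(real H)\<^sup>2 * sqrt x \<ge> 0" using x by simp
  have ju: "real j \<le> (real H)\<^sup>2 * sqrt x" and jl: "(real H)\<^sup>2 * sqrt x - 1 \<le> real j"
    unfolding j_def using j0 by linarith+
  have lnH: "0 \<le> ln (real H)" "ln (real H) \<le> real H" using H14 ln_le_minus_one[of "real H"] by auto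
  \<comment> \<open>The third factor \<open>ln x\<close> comes from the crude bound
    \<open>ln H \<le> H\<close>.\<close>
  have jH: "j * ln H \<le> (ln x) ^ 3 * sqrt x"
  proof -
    have "j * ln H \<le> (real H)\<^sup>2 * sqrt x * real H" using ju lnH j0 by (intro mult_mono) auto
    also have "\<dots> = real H ^ 3 * sqrt x" by (simp add: power2_eq_square power3_eq_cube)
    also have "\<dots> \<le> (ln x) ^ 3 * sqrt x" using Hu x by (intro mult_right_mono power_mono) auto
    finally show ?thesis .
  qed
  then have jx: "j * ln H \<le> x" using n(3) unfolding x_def by simp
  have lnpow: "ln (n * real H ^ i) = x + i * ln H" for i
    using n2 H14 unfolding x_def by (simp add: ln_mult ln_realpow)
  have ln2: "1 / 2 \<le> ln (2::real)" using ln_le_minus_one[of "1/2"] by (simp add: ln_div)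
  have "log 2 (n * real H ^ j) \<le> 4 * x"
  proof -
    have "log 2 (n * real H ^ j) \<le> (2 * x) / ln 2" unfolding log_def lnpow using jx by (intro divide_right_mono) auto
    also have "\<dots> \<le> (2 * x) / (1 / 2)" using x ln2 by (intro divide_left_mono) auto
    finally show ?thesis by simp
  qed
  then have "sqrt (log 2 (n * real H ^ j)) \<le> sqrt (4 * x)" by (rule real_sqrt_le_mono)
  also have "\<dots> = 2 * sqrt x" by (simp add: real_sqrt_mult)
  finally have sq: "sqrt (log 2 (n * real H ^ j)) \<le> 2 * sqrt x" .
  have "0 \<le> log 2 (n * real H ^ j)" unfolding log_def lnpow using x lnH by auto
  then have "ln 2 * (6 * sqrt (log 2 (n * real H ^ j)) + 2) \<le> 1 * (6 * sqrt (log 2 (n * real H ^ j)) + 2)"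
    using ln_2_less_1 by (intro mult_right_mono) auto
  also have "\<dots> \<le> 12 * sqrt x + 2" using sq by simp
  \<comment> \<open>This uses \<open>sqrt x \<ge> 2\<close>; the next line needs
    \<open>H \<ge> 14\<close>, which the bound 15 on \<open>ln (ln n)\<close> provides.\<close>
  also have "\<dots> < 14 * sqrt x - 1" using sx by linarith
  also have "\<dots> \<le> H * sqrt x - 1" using H14 x by (intro diff_right_mono mult_right_mono) auto
  also have "\<dots> \<le> ((real H)\<^sup>2 * sqrt x - 1) / H" using H14 by (simp add: field_simps power2_eq_square)
  also have "\<dots> \<le> j / H" using jl by (intro divide_right_mono) auto
  finally have "ln 2 * (6 * sqrt (log 2 (n * H ^ j)) + 2) < j / H" by simp
  then obtain i where i: "i < j"
    and step: "(1 - 1 / H) * (real (g_ap k (n * H ^ i)) / real (n * H ^ i))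
      \<le> real (g_ap k (n * H ^ Suc i)) / real (n * H ^ Suc i)"
    using density_nearly_constant_step[OF k, of n H j] n2 H14 by auto
  define m where "m = n * H ^ i"
  have nm: "n \<le> m" unfolding m_def using H14 by simp
  have lnm: "ln (real m) = x + i * ln H" unfolding m_def using lnpow[of i] by simp
  have "i * ln H \<le> j * ln H" using i lnH by (intro mult_right_mono) auto
  then have lnm2: "ln (real m) \<le> x + (ln x) ^ 3 * sqrt x" "ln (real m) \<le> 2 * x" using lnm jH jx by linarith+
  have "real m = exp (ln (real m))" using nm n2 by simp
  also have "\<dots> \<le> exp (x + (ln x) ^ 3 * sqrt x)" using lnm2 by simp
  also have "\<dots> = n * exp ((ln x) ^ 3 * sqrt x)" using n2 by (simp add: exp_add x_def)
  finally have mu: "real m \<le> n * exp ((ln x) ^ 3 * sqrt x)" .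
  have "x \<le> ln (real m)" using nm n2 unfolding x_def by simp
  then have l1: "ln x \<le> ln (ln m)" using x by simp
  have "ln (ln m) \<le> ln (2 * x)" using lnm2 \<open>x \<le> ln (real m)\<close> x by simp
  also have "\<dots> \<le> 1 + ln x" using x ln_2_less_1 by (simp add: ln_mult)
  finally have l2: "ln (ln m) \<le> 1 + ln x" .
  have "m \<in> good k"
  proof (rule good_if_density_nearly_constant[OF k, of m H])
    show "(1 - 1 / H) * (real (g_ap k m) / m) \<le> real (g_ap k (m * H)) / real (m * H)"
      using step unfolding m_def by (simp add: mult_ac)
    show "2 < ln (ln m)" using l1 n(2) unfolding x_def by linarith
    \<comment> \<open>The floor in \<open>H\<close> loses at most 1 and passing from
      \<open>n\<close> to \<open>m\<close> adds at most 1: hence the 2 in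
      \<open>ap_defect\<close>.\<close>
    show "ln (ln m) - 2 \<le> H" using l2 Hl by linarith
  qed (use nm n2 H14 in auto)
  with nm mu show ?thesis unfolding x_def by blast
qed

text \<open>A base other than \<open>1\<close> lets the exponent \<open>\<eta> n\<close> be chosen freely for small \<open>n\<close>.\<close>

lemma ln_nat_neq_1: "ln (real n) \<noteq> 1"
proof
  assume a: "ln (real n) = 1"
  then have "n > 0" by (cases n) auto
  with a have e: "real n = exp 1" by (metis exp_ln of_nat_0_less_iff)
  \<comment> \<open>The fourth power of 21/16 is below 3, so \<open>exp 1\<close> lies strictly
    between 2 and 3 and is no integer.\<close>
  have "exp (1/4::real) \<le> 1 + 1/4 + (1/4)^2" by (rule exp_bound) auto
  then have "exp (1/4::real) ^ 4 \<le> (21/16) ^ 4" by (intro power_mono) (auto simp: power2_eq_square)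
  then have "exp (1::real) < 3" by (simp add: exp_of_nat_mult[symmetric] power_divide)
  moreover have "ln 2 < (1::real)" by (rule ln_2_less_1)
  then have "exp (1::real) > 2" by (metis exp_less_mono exp_ln zero_less_numeral)
  ultimately have "2 < n" "n < 3" using e by linarith+
  then show False by simp
qed

theorem theorem1:
  fixes k :: nat
  assumes "k \<ge> 3"
  shows "\<exists>(s :: nat \<Rightarrow> nat) (\<delta> :: nat \<Rightarrow> real).
           strict_mono s \<and>
           \<delta> \<longlonglongrightarrow> 0 \<and>
           (\<forall>n\<in>range s. real (phi_ap k n) > (1/4 + \<delta> n) * real (g_ap k n)) \<and>
           (\<exists>\<eta> :: nat \<Rightarrow> real.
              \<eta> \<longlonglongrightarrow> 0 \<and>
              (\<forall>n\<ge>1. \<exists>m\<in>range s.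
                 real m \<in> {real n .. real n * exp (ln (real n) powr (1/2 + \<eta> n))}))"
proof -
  \<comment> \<open>Chosen so that \<open>ln n powr \<eta>0 n = (ln (ln n)) ^ 3\<close> for large
    \<open>n\<close>, the factor in \<open>good_in_segment\<close>.\<close>
  define \<eta>0 :: "nat \<Rightarrow> real" where "\<eta>0 n = 3 * ln (ln (ln (real n))) / ln (ln (real n))" for n
  define Q :: "nat \<Rightarrow> real \<Rightarrow> bool" where
    "Q n e \<longleftrightarrow> (\<exists>m\<in>good k. real m \<in> {real n .. real n * exp (ln (real n) powr (1/2 + e))})" for n e
  have ev: "\<forall>\<^sub>F n in sequentially. Q n (\<eta>0 n)"
  proof -
    have "\<forall>\<^sub>F n::nat in sequentially. ln (real n) \<ge> 4" by real_asymp
    moreover have "\<forall>\<^sub>F n::nat in sequentially. ln (ln (real n)) \<ge> 15" by real_asymp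
    moreover have "\<forall>\<^sub>F n::nat in sequentially. (ln (ln (real n))) ^ 3 * sqrt (ln (real n)) \<le> ln (real n)" by real_asymp
    ultimately show ?thesis
    proof eventually_elim
      case (elim n)
      define L where "L = ln (ln (real n))"
      have L: "L > 0" "ln (real n) > 0" using elim unfolding L_def by auto
      have "ln (real n) powr (1/2 + \<eta>0 n) = sqrt (ln (real n)) * exp (\<eta>0 n * L)"
        using L by (simp only: powr_add powr_half_sqrt) (simp add: powr_def L_def)
      also have "exp (\<eta>0 n * L) = exp (3 * ln L)" using L unfolding \<eta>0_def L_def[symmetric] by simp
      also have "\<dots> = L ^ 3" using L exp_of_nat_mult[of 3 "ln L"] by simp
      finally have "ln (real n) powr (1/2 + \<eta>0 n) = L ^ 3 * sqrt (ln (real n))" by simp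
      with good_in_segment[OF assms elim] show ?case unfolding Q_def L_def by auto
    qed
  qed
  have inf: "infinite (good k)"
  proof
    assume "finite (good k)"
    then obtain b where b: "\<And>m. m \<in> good k \<Longrightarrow> m < b" by (meson finite_nat_set_iff_bounded)
    from ev obtain n0 where "\<And>n. n \<ge> n0 \<Longrightarrow> Q n (\<eta>0 n)" by (auto simp: eventually_sequentially)
    from this[of "max n0 b"] obtain m where "m \<in> good k" "max n0 b \<le> m" unfolding Q_def by auto
    with b show False by fastforce
  qed
  have all: "\<exists>e. Q n e" if "n \<ge> 1" for n
  proof (cases "n = 1")
    case True
    \<comment> \<open>Since \<open>ln 1 = 0\<close> and \<open>0 powr a = 0\<close>, the segment is
      \<open>{1}\<close> for every exponent.\<close>
    then show ?thesis unfolding Q_def using one_in_good[OF assms] by auto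
  next
    case False
    then have n: "n \<ge> 2" using that by simp
    obtain m where m: "m \<in> good k" "m > n" using inf by (meson infinite_nat_iff_unbounded)
    let ?x = "ln (real n)" and ?y = "ln (real m / real n)"
    have x: "?x > 0" "?x \<noteq> 1" using n ln_nat_neq_1 by auto
    have y: "?y > 0" using m n by simp
    \<comment> \<open>The exponent is solved for so that the segment ends exactly at the good number
      \<open>m\<close>.\<close>
    have "?x powr (1/2 + (log ?x ?y - 1/2)) = ?y" using x y by simp
    then have "real n * exp (?x powr (1/2 + (log ?x ?y - 1/2))) = m" using n m by simp
    then have "Q n (log ?x ?y - 1/2)" unfolding Q_def using m by (intro bexI[of _ m]) auto
    then show ?thesis ..
  qed
  \<comment> \<open>\<open>\<eta>\<close> differs from \<open>\<eta>0\<close> at only finitely many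
    \<open>n\<close>, so the limit is unaffected.\<close>
  define \<eta> where "\<eta> n = (if Q n (\<eta>0 n) then \<eta>0 n else (SOME e. Q n e))" for n
  have "\<eta> \<longlonglongrightarrow> 0"
  proof (rule Lim_transform_eventually)
    show "\<eta>0 \<longlonglongrightarrow> 0" unfolding \<eta>0_def by real_asymp
    show "\<forall>\<^sub>F n in sequentially. \<eta>0 n = \<eta> n" using ev by eventually_elim (simp add: \<eta>_def)
  qed
  moreover have "Q n (\<eta> n)" if "n \<ge> 1" for n
    using someI_ex[OF all[OF that]] unfolding \<eta>_def by auto
  moreover have "range (enumerate (good k)) = good k" using inf by (rule range_enumerate)
  moreover have "strict_mono (enumerate (good k))" using inf by (rule strict_mono_enumerate)
  moreover have "\<forall>n\<in>good k. real (phi_ap k n) > (1/4 + ap_defect n) * real (g_ap k n)"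
    unfolding good_def by blast
  ultimately show ?thesis unfolding Q_def
    by (intro exI[of _ "enumerate (good k)"] exI[of _ ap_defect] conjI ap_defect_tendsto_0 exI[of _ \<eta>]) auto
qed

end
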